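(* Let $a,m$ be integers with $3\le a\le m-1$, let $\gamma=a\,2\,3\cdots(a-1)\,(a+1)\cdots m\,1\in\mathcal S_m$ (that is, $a$, followed by the elements of $\{2,\dots,m\}\setminus\{a\}$ in increasing order, followed by $1$), and let $B=B(t,x)=\sum_{n\ge 0}t^n\sum_{\sigma\in\mathcal S_n(132)}x^{\gamma\text{-mch}(\sigma)}$. Then $$B=\frac{tB^{m-a+2}+t^{a-2}(x-1)(B-1-tB)(B-1)^{m-a}}{(B-1)B^{m-a-1}}.$$
   Context: $\mathcal S_n$ is the set of permutations of $\{1,\dots,n\}$ in one-line notation ($\mathcal S_0$ contains only the empty permutation, on which all statistics are $0$). For a word $w$ of distinct integers, $\mathrm{red}(w)$ replaces the $i$-th smallest letter by $i$. $\sigma\in\mathcal S_n$ avoids $\lambda\in\mathcal S_k$ (classical avoidance) if no (not necessarily contiguous) subsequence $\sigma_{i_1}\cdots\sigma_{i_k}$, $i_1<\dots<i_k$, has reduction $\lambda$; $\mathcal S_n(\lambda)$ is the set of such $\sigma$. $\gamma\text{-mch}(\sigma)$ is the number of $i$ with $\mathrm{red}(\sigma_i\sigma_{i+1}\cdots\sigma_{i+k-1})=\gamma$ for $\gamma\in\mathcal S_k$. The identity is in the fraction field of $\mathbb Q[x][[t]]$ (note $B\ne 1$). *)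

theory Defs
  imports
    "HOL-Library.Sublist"
    "HOL-Combinatorics.Multiset_Permutations"
    "HOL-Computational_Algebra.Polynomial_Factorial"
    "HOL-Computational_Algebra.Formal_Power_Series"
begin

text \<open>Permutations in one-line notation are lists: the set of permutations of
  \<open>1, \<dots>, n\<close> is \<^term>\<open>permutations_of_set {1..n::nat}\<close>.\<close>

definition red :: "nat list \<Rightarrow> nat list" where
  "red w = map (\<lambda>v. card {u \<in> set w. u \<le> v}) w"

definition avoids :: "nat list \<Rightarrow> nat list \<Rightarrow> bool" where
  "avoids \<sigma> pat \<longleftrightarrow> (\<nexists>w. subseq w \<sigma> \<and> red w = pat)"

definition avoiders :: "nat \<Rightarrow> nat list \<Rightarrow> nat list set" where
  "avoiders n pat = {\<sigma> \<in> permutations_of_set {1..n}. avoids \<sigma> pat}"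

text \<open>Positions are counted from 0; for a nonempty pattern the bound on \<open>i\<close>
  leaves no match in the empty permutation.\<close>

definition mch :: "nat list \<Rightarrow> nat list \<Rightarrow> nat" where
  "mch pat \<sigma> = card {i. i + length pat \<le> length \<sigma> \<and>
     red (take (length pat) (drop i \<sigma>)) = pat}"

definition gamma_perm :: "nat \<Rightarrow> nat \<Rightarrow> nat list" where
  "gamma_perm a m = a # sorted_list_of_set ({2..m} - {a}) @ [1]"

text \<open>The variable \<open>x\<close> is the polynomial indeterminate \<open>[:0, 1:]\<close>, and \<open>t\<close> is \<^const>\<open>fps_X\<close>.\<close>

definition match_gf :: "nat list \<Rightarrow> nat list \<Rightarrow> rat poly fps" where
  "match_gf pat \<gamma> = Abs_fps (\<lambda>n. \<Sum>\<sigma>\<in>avoiders n pat. [:0, 1:] ^ mch \<gamma> \<sigma>)"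

end

theory Submission
  imports Defs
begin

text \<open>
  A nonempty 132-avoiding permutation is \<open>L N R\<close> with \<open>N\<close> its maximum and every letter of \<open>L\<close>
  above every letter of \<open>R\<close>. A match of \<open>\<gamma>\<close> uses \<open>N\<close> precisely when \<open>R\<close> is nonempty and \<open>L\<close> ends
  with a copy of \<open>\<gamma>\<close> without its two last letters. Let \<open>F\<^sub>k\<close> be the part of \<open>B\<close> from the avoiders that end with a copy
  of the first \<open>a - 1 + k\<close> letters of \<open>\<gamma>\<close>, and put \<open>K = m - 1 - a\<close> and \<open>P = B + (x - 1) F\<^sub>K\<close>. The position of
  the maximum in these prefixes gives
  \<open>B - 1 = t (B + P (B - 1))\<close>, \<open>F\<^sub>k\<^sub>+\<^sub>1 = t (F\<^sub>k + P F\<^sub>k\<^sub>+\<^sub>1)\<close> and \<open>F\<^sub>0 = t (P t\<^sup>a\<^sup>-\<^sup>2 + P F\<^sub>0)\<close>.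
  The first equation eliminates \<open>P\<close>, so that \<open>B F\<^sub>k\<^sub>+\<^sub>1 = (B - 1) F\<^sub>k\<close> and
  \<open>t B F\<^sub>0 = (B - 1 - t B) t\<^sup>a\<^sup>-\<^sup>2\<close>, and substituting \<open>F\<^sub>K\<close> into it yields the identity for \<open>B\<close>.
\<close>

section \<open>Reductions of words\<close>

lemma length_red [simp]: "length (red w) = length w"
  by (simp add: red_def)

lemma red_shift [simp]: "red (map ((+) c) w) = red w"
proof -
  have "card {u \<in> (+) c ` set w. u \<le> c + v} = card {u \<in> set w. u \<le> v}" for v
  proof -
    have "{u \<in> (+) c ` set w. u \<le> c + v} = (+) c ` {u \<in> set w. u \<le> v}"
      by auto
    then show ?thesis
      by (simp add: card_image)
  qed
  then show ?thesis
    by (simp add: red_def)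
qed

lemma red_snoc_max:
  assumes "distinct w" "\<And>u. u \<in> set w \<Longrightarrow> u < N"
  shows "red (w @ [N]) = red w @ [Suc (length w)]"
proof -
  have "{u. (u = N \<or> u \<in> set w) \<and> u \<le> N} = insert N (set w)"
    using assms(2) by (auto intro: less_imp_le)
  moreover have "N \<notin> set w"
    using assms(2) by blast
  moreover have "{u. (u = N \<or> u \<in> set w) \<and> u \<le> v} = {u \<in> set w. u \<le> v}" if "v \<in> set w" for v
    using assms(2)[OF that] by auto
  ultimately show ?thesis
    using assms(1) by (simp add: red_def distinct_card)
qed

lemma red_Cons_max:
  assumes "distinct w" "\<And>u. u \<in> set w \<Longrightarrow> u < N"
  shows "red (N # w) = Suc (length w) # red w"
proof -
  have "{u. (u = N \<or> u \<in> set w) \<and> u \<le> N} = insert N (set w)"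
    using assms(2) by (auto intro: less_imp_le)
  moreover have "N \<notin> set w"
    using assms(2) by blast
  moreover have "{u. (u = N \<or> u \<in> set w) \<and> u \<le> v} = {u \<in> set w. u \<le> v}" if "v \<in> set w" for v
    using assms(2)[OF that] by auto
  ultimately show ?thesis
    using assms(1) by (simp add: red_def distinct_card)
qed

lemma red_snoc_min:
  assumes "\<And>u. u \<in> set w \<Longrightarrow> h < u"
  shows "red (w @ [h]) = map Suc (red w) @ [1]"
proof -
  have h: "h \<notin> set w"
    using assms by blast
  have "{u \<in> set (w @ [h]). u \<le> h} = {h}"
    using assms by (auto dest: leD)
  moreover have "card {u \<in> set (w @ [h]). u \<le> v} = Suc (card {u \<in> set w. u \<le> v})"
    if "v \<in> set w" for v
  proof -
    have "{u \<in> set (w @ [h]). u \<le> v} = insert h {u \<in> set w. u \<le> v}"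
      using assms[OF that] by auto
    then show ?thesis
      using h by (simp only: card_insert_disjoint finite_set finite_Collect_conjI) simp
  qed
  ultimately show ?thesis
    unfolding red_def by (simp only: map_append map_map comp_def) (simp cong: map_cong)
qed

lemma red_ident:
  assumes "set w = {1..n}"
  shows "red w = w"
  unfolding red_def
proof (rule map_idI)
  fix v assume "v \<in> set w"
  with assms have "{u \<in> set w. u \<le> v} = {1..v}"
    by auto
  then show "card {u \<in> set w. u \<le> v} = v"
    by simp
qed

text \<open>The rank of the largest letter counts all letters. Words with the same reduction
  therefore have their maxima at the same position.\<close>

lemma red_nth_max:
  assumes "distinct w" "q < length w" "\<And>u. u \<in> set w \<Longrightarrow> u \<le> w ! q"
  shows "red w ! q = length w"
proof -
  have "{u \<in> set w. u \<le> w ! q} = set w"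
    using assms(3) by auto
  then show ?thesis
    using assms(1,2) by (simp add: red_def distinct_card)
qed

section \<open>Occurrences of 132 in a word\<close>

lemma red_eq_132_iff: "red w = [1, 3, 2] \<longleftrightarrow> (\<exists>x y z. w = [x, z, y] \<and> x < y \<and> y < z)"
proof
  assume red: "red w = [1, 3, 2]"
  then have "length w = 3"
    by (metis length_red length_Cons list.size(3) numeral_3_eq_3)
  then obtain x z y where w: "w = [x, z, y]"
    by (auto simp: numeral_3_eq_3 length_Suc_conv)
  let ?c = "\<lambda>v. card {u \<in> {x, z, y}. u \<le> v}"
  have c: "?c x = 1" "?c z = 3" "?c y = 2"
    using red by (simp_all add: red_def w)
  \<comment> \<open>The rank \<open>?c\<close> is monotone, so a strict inequality between ranks
    forces one between the letters.\<close>
  have mono: "?c u \<le> ?c v" if "u \<le> v" for u v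
    by (rule card_mono) (use that in auto)
  have "x < y" "y < z"
    using mono[of y x] mono[of z y] unfolding c by linarith+
  with w show "\<exists>x y z. w = [x, z, y] \<and> x < y \<and> y < z"
    by blast
next
  assume "\<exists>x y z. w = [x, z, y] \<and> x < y \<and> y < z"
  then obtain x y z where w: "w = [x, z, y]" "x < y" "y < z"
    by blast
  then have "{u \<in> {x, z, y}. u \<le> x} = {x}" "{u \<in> {x, z, y}. u \<le> y} = {x, y}"
    "{u \<in> {x, z, y}. u \<le> z} = {x, y, z}"
    by auto
  with w show "red w = [1, 3, 2]"
    by (simp add: red_def)
qed

lemma avoids_132_iff:
  "avoids \<sigma> [1, 3, 2] \<longleftrightarrow> (\<forall>x y z. subseq [x, z, y] \<sigma> \<longrightarrow> x < y \<longrightarrow> \<not> y < z)"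
  unfolding avoids_def red_eq_132_iff by blast

text \<open>The disjuncts sort the occurrences by how many of the three letters fall into
  \<open>xs\<close>; a letter that is alone in its factor becomes set membership.\<close>

lemma subseq_triple_append_iff:
  "subseq [u, v, w] (xs @ ys) \<longleftrightarrow>
    subseq [u, v, w] xs \<or> (subseq [u, v] xs \<and> w \<in> set ys) \<or>
    (u \<in> set xs \<and> subseq [v, w] ys) \<or> subseq [u, v, w] ys"
proof
  assume "subseq [u, v, w] (xs @ ys)"
  then show "subseq [u, v, w] xs \<or> (subseq [u, v] xs \<and> w \<in> set ys) \<or>
      (u \<in> set xs \<and> subseq [v, w] ys) \<or> subseq [u, v, w] ys"
    unfolding subseq_append_iff by (auto simp: Cons_eq_append_conv subseq_singleton_left)
next
  have "subseq [u, v, w] (xs @ ys)" if "subseq [u, v] xs" "w \<in> set ys"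
    using list_emb_append_mono[of "(=)" "[u, v]" xs "[w]" ys] that
    by (simp add: subseq_singleton_left)
  moreover have "subseq [u, v, w] (xs @ ys)" if "u \<in> set xs" "subseq [v, w] ys"
    using list_emb_append_mono[of "(=)" "[u]" xs "[v, w]" ys] that
    by (simp add: subseq_singleton_left)
  ultimately show "subseq [u, v, w] (xs @ ys)"
    if "subseq [u, v, w] xs \<or> (subseq [u, v] xs \<and> w \<in> set ys) \<or>
      (u \<in> set xs \<and> subseq [v, w] ys) \<or> subseq [u, v, w] ys"
    using that list_emb_append2[of "(=)" _ ys xs] list_emb_prefix[of "(=)" _ xs ys] by blast
qed

lemma subseq_subset: "subseq xs ys \<Longrightarrow> set xs \<subseteq> set ys"
  by (auto dest: list_emb_set)

lemma subseq_map_iff_inj: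
  assumes "inj f"
  shows "subseq (map f xs) (map f ys) \<longleftrightarrow> subseq xs ys"
proof
  assume "subseq (map f xs) (map f ys)"
  then have "subseq (map (inv f) (map f xs)) (map (inv f) (map f ys))"
    by (rule subseq_map)
  with assms show "subseq xs ys"
    by (simp add: comp_def)
qed (rule subseq_map)

lemma avoids_132_shift: "avoids (map ((+) c) \<sigma>) [1, 3, 2] \<longleftrightarrow> avoids \<sigma> [1, 3, 2]"
proof -
  have *: "subseq [c + x, c + z, c + y] (map ((+) c) \<sigma>) \<longleftrightarrow> subseq [x, z, y] \<sigma>" for x y z
    using subseq_map_iff_inj[of "(+) c" "[x, z, y]" \<sigma>] by simp
  \<comment> \<open>All letters of the shifted word are at least \<open>c\<close>, so every
    occurrence in it comes from a triple in \<open>\<sigma>\<close>.\<close>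
  have ge: "\<exists>x' y' z'. x = c + x' \<and> y = c + y' \<and> z = c + z'"
    if "subseq [x, z, y] (map ((+) c) \<sigma>)" for x y z
    using subseq_subset[OF that] by auto
  show ?thesis
    unfolding avoids_132_iff
  proof (intro iffI allI impI)
    fix x y z
    assume "\<forall>x y z. subseq [x, z, y] (map ((+) c) \<sigma>) \<longrightarrow> x < y \<longrightarrow> \<not> y < z"
      and "subseq [x, z, y] \<sigma>" "x < y"
    then show "\<not> y < z"
      using * by (metis add_less_cancel_left)
  next
    fix x y z
    assume "\<forall>x y z. subseq [x, z, y] \<sigma> \<longrightarrow> x < y \<longrightarrow> \<not> y < z"
      and "subseq [x, z, y] (map ((+) c) \<sigma>)" "x < y"
    then show "\<not> y < z"
      using ge[of x z y] by (auto simp: *)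
  qed
qed

section \<open>Splitting an avoider at its maximum\<close>

lemma avoids_132_split_max:
  assumes "\<And>u. u \<in> set L \<union> set R \<Longrightarrow> u < N"
  shows "avoids (L @ N # R) [1, 3, 2] \<longleftrightarrow>
    avoids L [1, 3, 2] \<and> avoids R [1, 3, 2] \<and> (\<forall>u \<in> set L. \<forall>v \<in> set R. v \<le> u)"
proof (intro iffI conjI ballI)
  assume av: "avoids (L @ N # R) [1, 3, 2]"
  show "avoids L [1, 3, 2]" "avoids R [1, 3, 2]"
    using av unfolding avoids_132_iff by (meson list_emb_append2 list_emb_prefix list_emb_Cons)+
  \<comment> \<open>Otherwise \<open>u\<close>, \<open>N\<close>, \<open>v\<close> would form 132
    with \<open>N\<close> as the largest letter.\<close>
  show "v \<le> u" if "u \<in> set L" "v \<in> set R" for u v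
  proof (rule ccontr)
    assume "\<not> v \<le> u"
    moreover have "subseq [u, N, v] (L @ N # R)"
      unfolding subseq_triple_append_iff using that by (simp add: subseq_singleton_left)
    ultimately show False
      using av assms[of v] that unfolding avoids_132_iff by (meson UnI2 not_le)
  qed
next
  assume *: "avoids L [1, 3, 2] \<and> avoids R [1, 3, 2] \<and> (\<forall>u \<in> set L. \<forall>v \<in> set R. v \<le> u)"
  show "avoids (L @ N # R) [1, 3, 2]"
    unfolding avoids_132_iff
  proof (intro allI impI notI)
    fix x y z assume s: "subseq [x, z, y] (L @ N # R)" "x < y" "y < z"
    have y: "y \<in> set (L @ N # R)" and x: "x \<in> set (L @ N # R)" and z: "z \<in> set (L @ N # R)"
      using subseq_subset[OF s(1)] by auto
    \<comment> \<open>Since \<open>x\<close> and \<open>y\<close> lie below \<open>z\<close>,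
      neither of them is \<open>N\<close>; only the middle letter of the occurrence can be.\<close>
    have "z \<le> N"
      using assms[of z] z by auto
    with s(3) have y': "y < N" by simp
    with s(2) have x': "x < N" by simp
    from s(1) consider "subseq [x, z, y] L" | "subseq [x, z] L" "y \<in> set (N # R)"
      | "x \<in> set L" "subseq [z, y] (N # R)" | "subseq [x, z, y] (N # R)"
      unfolding subseq_triple_append_iff by blast
    then show False
    proof cases
      case 1
      with * s show ?thesis unfolding avoids_132_iff by blast
    next
      case 2
      then have "x \<in> set L" "y \<in> set R"
        using subseq_subset[OF 2(1)] y' by auto
      with * s show ?thesis by (meson leD)
    next
      case 3
      then have "x \<in> set L" "y \<in> set R"
        using subseq_subset[OF 3(2)] y' by auto
      with * s show ?thesis by (meson leD)
    next
      case 4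
      then have "subseq [x, z, y] R"
        using x' by simp
      with * s show ?thesis unfolding avoids_132_iff by blast
    qed
  qed
qed

text \<open>Both arguments are meant to be permutations of initial segments. The shift by
  \<open>length R\<close> lifts \<open>L\<close> above \<open>R\<close>, as avoidance of 132
  demands, and makes room for a new maximum between them.\<close>

definition join :: "nat list \<Rightarrow> nat list \<Rightarrow> nat list" where
  "join L R = map ((+) (length R)) L @ Suc (length L + length R) # R"

lemma length_join [simp]: "length (join L R) = Suc (length L + length R)"
  by (simp add: join_def)

lemma join_nth_length [simp]: "join L R ! length L = Suc (length L + length R)"
  by (simp add: join_def nth_append)

lemma avoidersD:
  assumes "\<sigma> \<in> avoiders n p"
  shows "set \<sigma> = {1..n}" "distinct \<sigma>" "length \<sigma> = n"
  using assms distinct_card[of \<sigma>] by (auto simp: avoiders_def permutations_of_set_def)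

lemma finite_avoiders [simp]: "finite (avoiders n p)"
  by (simp add: avoiders_def)

lemma set_shift_interval: "set xs = {1..k} \<Longrightarrow> (+) r ` set xs = {Suc r..r + k}" for r :: nat
  by (simp add: image_add_atLeastAtMost)

lemma
  assumes "set L = {1..length L}" "set R = {1..length R}"
  shows set_join: "set (join L R) = {1..Suc (length L + length R)}"
    and distinct_join: "distinct (join L R)"
proof -
  show *: "set (join L R) = {1..Suc (length L + length R)}"
    using assms by (auto simp: join_def set_shift_interval)
  show "distinct (join L R)"
    by (rule card_distinct) (simp add: *)
qed

lemma join_in_avoiders:
  assumes "L \<in> avoiders k [1, 3, 2]" "R \<in> avoiders (n - k) [1, 3, 2]" "k \<le> n"
  shows "join L R \<in> avoiders (Suc n) [1, 3, 2]"
proof -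
  note L = avoidersD[OF assms(1)] and R = avoidersD[OF assms(2)]
  have "avoids (join L R) [1, 3, 2]"
    unfolding join_def
  proof (subst avoids_132_split_max)
    show "avoids (map ((+) (length R)) L) [1, 3, 2] \<and> avoids R [1, 3, 2] \<and>
        (\<forall>u\<in>set (map ((+) (length R)) L). \<forall>v\<in>set R. v \<le> u)"
      using assms L R by (auto simp: avoids_132_shift avoiders_def simp del: One_nat_def)
  qed (use L R in auto)
  moreover have "distinct (join L R)" "set (join L R) = {1..Suc n}"
    using distinct_join[of L R] set_join[of L R] L R assms(3) by auto
  ultimately show ?thesis
    by (simp add: avoiders_def permutations_of_set_def)
qed

text \<open>Serves to recognise the letters after the maximum of an avoider, a downward closed set,
  as an initial segment.\<close>

lemma initial_segment_eq:
  fixes S :: "nat set"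
  assumes "finite S" "\<And>u. u \<in> S \<Longrightarrow> 0 < u" "\<And>u v. u \<in> S \<Longrightarrow> 0 < v \<Longrightarrow> v < u \<Longrightarrow> v \<in> S"
  shows "S = {1..card S}"
proof (cases "S = {}")
  case False
  with assms(1) have M: "Max S \<in> S" "\<And>u. u \<in> S \<Longrightarrow> u \<le> Max S"
    by auto
  have "S = {1..Max S}"
  proof (intro equalityI subsetI)
    fix u assume "u \<in> {1..Max S}"
    then show "u \<in> S"
      using assms(3)[OF M(1), of u] M(1) by (cases "u = Max S") auto
  qed (use assms(2) M in force)
  then show ?thesis
    by (metis card_atLeastAtMost diff_Suc_1)
qed simp

lemma avoiders_Suc_split:
  assumes "\<sigma> \<in> avoiders (Suc n) [1, 3, 2]"
  obtains k L R where "k \<le> n" "L \<in> avoiders k [1, 3, 2]" "R \<in> avoiders (n - k) [1, 3, 2]"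
    "\<sigma> = join L R"
proof -
  note \<sigma> = avoidersD[OF assms]
  then have "Suc n \<in> set \<sigma>" by simp
  then obtain L' R where eq: "\<sigma> = L' @ Suc n # R"
    by (meson split_list)
  have dist: "distinct L'" "distinct R" "set L' \<inter> set R = {}" "Suc n \<notin> set L' \<union> set R"
    using \<sigma>(2) eq by auto
  have un: "set L' \<union> set R = {1..n}"
  proof -
    have "insert (Suc n) (set L' \<union> set R) = insert (Suc n) {1..n}"
      using \<sigma>(1) eq by (simp add: atLeastAtMostSuc_conv)
    with dist(4) show ?thesis
      by (metis atLeastAtMost_iff insert_ident not_less_eq_eq order_refl)
  qed
  have lt: "u < Suc n" if "u \<in> set L' \<union> set R" for u
    using that un by auto
  have av: "avoids L' [1, 3, 2]" "avoids R [1, 3, 2]"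
    and le: "\<And>u v. u \<in> set L' \<Longrightarrow> v \<in> set R \<Longrightarrow> v \<le> u"
    using assms lt avoids_132_split_max[of L' R "Suc n"] by (auto simp: avoiders_def eq)
  let ?r = "length R"
  have setR: "set R = {1..?r}"
  proof -
    \<comment> \<open>A positive value below a letter of \<open>R\<close> cannot lie in
      \<open>L'\<close>, whose letters are all above those of \<open>R\<close>; so
      \<open>set R\<close> is downward closed.\<close>
    have "set R = {1..card (set R)}"
    proof (rule initial_segment_eq)
      fix u v assume *: "u \<in> set R" "0 < v" "v < u"
      with un have "v \<in> set L' \<union> set R"
        by (metis One_nat_def Suc_leI UnI2 atLeastAtMost_iff le_trans less_imp_le)
      with * le[of v u] show "v \<in> set R" by auto
    qed (use un in force)+
    then show ?thesis
      using dist(2) by (simp add: distinct_card)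
  qed
  have len: "length L' + ?r = n"
    using \<sigma>(3) eq by simp
  have setL': "set L' = {Suc ?r..n}"
  proof -
    have "set L' = {1..n} - {1..?r}"
      using un dist(3) unfolding setR [symmetric] by blast
    also have "\<dots> = {Suc ?r..n}"
      unfolding set_eq_iff Diff_iff atLeastAtMost_iff by presburger
    finally show ?thesis .
  qed
  \<comment> \<open>The truncated subtraction loses nothing, since all letters of \<open>L'\<close>
    exceed \<open>?r\<close>.\<close>
  define L where "L = map (\<lambda>v. v - ?r) L'"
  have L': "map ((+) ?r) L = L'"
    unfolding L_def map_map comp_def by (rule map_idI) (use setL' in auto)
  have "L \<in> avoiders (length L') [1, 3, 2]"
  proof -
    have "(+) ?r ` set L = set L'"
      using L' by (metis set_map)
    also have "\<dots> = (+) ?r ` {1..length L'}"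
      using len setL' by (simp add: image_add_atLeastAtMost add.commute)
    finally have "(+) ?r ` set L = (+) ?r ` {1..length L'}" .
    then have "set L = {1..length L'}"
      by (subst (asm) inj_image_eq_iff) simp_all
    moreover have "distinct L"
      using dist(1) L' by (metis distinct_map)
    moreover have "avoids L [1, 3, 2]"
      using av(1) L' by (metis avoids_132_shift)
    ultimately show ?thesis
      by (simp add: avoiders_def permutations_of_set_def)
  qed
  moreover have "R \<in> avoiders (n - length L') [1, 3, 2]"
    using setR dist(2) av(2) len by (auto simp: avoiders_def permutations_of_set_def)
  moreover have "\<sigma> = join L R"
    using L' len by (simp add: join_def eq L_def add.commute)
  ultimately show thesis
    using that[of "length L'" L R] len by simp
qed

text \<open>Equal total lengths give both words the same maximum, and a word splits in only one way
  at a letter that occurs once. Then \<open>R = R'\<close> makes the two shifts equal.\<close>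

lemma join_inject:
  assumes "length L + length R = length L' + length R'"
    "set L = {1..length L}" "set R = {1..length R}" "set L' = {1..length L'}" "set R' = {1..length R'}"
    "join L R = join L' R'"
  shows "L = L' \<and> R = R'"
proof -
  let ?N = "Suc (length L + length R)"
  have *: "?N \<notin> set (map ((+) (length R)) L)" "?N \<notin> set R"
    "?N \<notin> set (map ((+) (length R')) L')" "?N \<notin> set R'"
    using assms(1-5) by auto
  have "map ((+) (length R)) L = map ((+) (length R')) L' \<and> R = R'"
    using assms(1,6) * unfolding join_def by (metis append_Cons_eq_iff)
  then show ?thesis
    by (auto simp: inj_map_eq_map)
qed

text \<open>The Catalan decomposition: \<open>join\<close> is a bijection from the triples
  \<open>(k, L, R)\<close> to the avoiders of length \<open>Suc n\<close>.\<close>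

lemma sum_avoiders_Suc:
  fixes w :: "nat list \<Rightarrow> 'a :: comm_monoid_add"
  shows "(\<Sum>\<sigma>\<in>avoiders (Suc n) [1, 3, 2]. w \<sigma>) =
    (\<Sum>k\<le>n. \<Sum>L\<in>avoiders k [1, 3, 2]. \<Sum>R\<in>avoiders (n - k) [1, 3, 2]. w (join L R))"
proof -
  let ?A = "\<lambda>k. avoiders k [1, 3, 2]"
  let ?S = "SIGMA k:{..n}. ?A k \<times> ?A (n - k)"
  have "bij_betw (\<lambda>(k, L, R). join L R) ?S (?A (Suc n))"
    unfolding bij_betw_def
  proof
    show "inj_on (\<lambda>(k, L, R). join L R) ?S"
    proof (rule inj_onI)
      fix p p' assume p: "p \<in> ?S" "p' \<in> ?S"
        and eq: "(\<lambda>(k, L, R). join L R) p = (\<lambda>(k, L, R). join L R) p'"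
      obtain k L R k' L' R' where pp: "p = (k, L, R)" "p' = (k', L', R')"
        by (metis prod_cases3)
      with p have k: "k \<le> n" "k' \<le> n"
        and m: "L \<in> ?A k" "R \<in> ?A (n - k)" "L' \<in> ?A k'" "R' \<in> ?A (n - k')"
        by auto
      note d = m[THEN avoidersD(1)] m[THEN avoidersD(3)]
      have "L = L' \<and> R = R'"
        using join_inject[of L R L' R'] d k eq pp by simp
      with d pp show "p = p'" by auto
    qed
    show "(\<lambda>(k, L, R). join L R) ` ?S = ?A (Suc n)"
    proof (intro equalityI subsetI)
      fix \<sigma> assume "\<sigma> \<in> ?A (Suc n)"
      then obtain k L R where "k \<le> n" "L \<in> ?A k" "R \<in> ?A (n - k)" "\<sigma> = join L R"
        by (rule avoiders_Suc_split)
      then show "\<sigma> \<in> (\<lambda>(k, L, R). join L R) ` ?S"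
        by (auto intro!: image_eqI[of _ _ "(k, L, R)"])
    qed (auto intro: join_in_avoiders simp del: One_nat_def)
  qed
  then have "(\<Sum>\<sigma>\<in>?A (Suc n). w \<sigma>) = (\<Sum>p\<in>?S. w ((\<lambda>(k, L, R). join L R) p))"
    by (rule sum.reindex_bij_betw [symmetric])
  also have "\<dots> = (\<Sum>k\<le>n. \<Sum>(L, R)\<in>?A k \<times> ?A (n - k). w (join L R))"
    by (subst sum.Sigma) (auto simp: case_prod_unfold)
  finally show ?thesis
    by (simp add: sum.cartesian_product)
qed

section \<open>Weighted generating functions of avoiders\<close>

definition avoider_gf :: "(nat list \<Rightarrow> 'a) \<Rightarrow> 'a :: comm_ring_1 fps" where
  "avoider_gf w = Abs_fps (\<lambda>n. \<Sum>\<sigma>\<in>avoiders n [1, 3, 2]. w \<sigma>)"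

text \<open>Pairs are graded by total length. The weight need not be a product, so the weight of a
  \<open>join\<close> can be entered first and split into products afterwards.\<close>

definition pair_gf :: "(nat list \<Rightarrow> nat list \<Rightarrow> 'a) \<Rightarrow> 'a :: comm_ring_1 fps" where
  "pair_gf h = Abs_fps (\<lambda>n. \<Sum>k\<le>n. \<Sum>L\<in>avoiders k [1, 3, 2]. \<Sum>R\<in>avoiders (n - k) [1, 3, 2]. h L R)"

lemma avoiders_0: "avoiders 0 [1, 3, 2] = {[]}"
  by (auto simp: avoiders_def avoids_132_iff simp del: One_nat_def)

text \<open>The factor \<open>fps_X\<close> counts the maximum that \<open>join\<close> inserts, and
  the constant term is the empty permutation.\<close>

lemma avoider_gf_rec:
  "avoider_gf w = fps_const (w []) + fps_X * pair_gf (\<lambda>L R. w (join L R))"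
proof (rule fps_ext)
  fix n
  show "fps_nth (avoider_gf w) n = fps_nth (fps_const (w []) + fps_X * pair_gf (\<lambda>L R. w (join L R))) n"
    by (cases n) (simp_all add: avoider_gf_def pair_gf_def avoiders_0 sum_avoiders_Suc
        del: One_nat_def)
qed

lemma pair_gf_mult: "pair_gf (\<lambda>L R. u L * v R) = avoider_gf u * avoider_gf v"
  by (simp add: fps_eq_iff pair_gf_def avoider_gf_def fps_mult_nth sum_product atLeast0AtMost)

lemma pair_gf_add: "pair_gf (\<lambda>L R. h L R + h' L R) = pair_gf h + pair_gf h'"
  by (simp add: fps_eq_iff pair_gf_def sum.distrib)

lemma pair_gf_cong:
  assumes "\<And>L R. set L = {1..length L} \<Longrightarrow> set R = {1..length R} \<Longrightarrow> h L R = h' L R"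
  shows "pair_gf h = pair_gf h'"
  unfolding pair_gf_def using assms
  by (intro arg_cong[of _ _ Abs_fps] ext sum.cong refl) (auto simp: avoidersD simp del: One_nat_def)

lemma avoider_gf_add: "avoider_gf (\<lambda>\<sigma>. u \<sigma> + v \<sigma>) = avoider_gf u + avoider_gf v"
  by (simp add: fps_eq_iff avoider_gf_def sum.distrib)

lemma avoider_gf_cmult: "avoider_gf (\<lambda>\<sigma>. c * u \<sigma>) = fps_const c * avoider_gf u"
  by (simp add: fps_eq_iff avoider_gf_def sum_distrib_left)

lemma avoider_gf_of_bool:
  assumes "p \<in> avoiders n [1, 3, 2]"
  shows "avoider_gf (\<lambda>\<sigma>. of_bool (\<sigma> = p) * w \<sigma>) = fps_const (w p) * fps_X ^ n"
proof (rule fps_ext)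
  fix k
  have "p \<in> avoiders k [1, 3, 2] \<longleftrightarrow> k = n"
    using assms avoidersD(3)[of p] by metis
  then show "fps_nth (avoider_gf (\<lambda>\<sigma>. of_bool (\<sigma> = p) * w \<sigma>)) k = fps_nth (fps_const (w p) * fps_X ^ n) k"
    by (simp add: avoider_gf_def of_bool_def if_distrib[of "\<lambda>c. c * _"] sum.delta' cong: if_cong)
qed

section \<open>Matches in a joined permutation\<close>

definition suffix_match :: "nat list \<Rightarrow> nat list \<Rightarrow> bool" where
  "suffix_match p \<sigma> \<longleftrightarrow> length p \<le> length \<sigma> \<and> red (drop (length \<sigma> - length p) \<sigma>) = p"

lemma drop_join_right: "k \<le> length R \<Longrightarrow> drop (length (join L R) - k) (join L R) = drop (length R - k) R"
  by (simp add: join_def Suc_diff_le drop_Cons')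

lemma drop_join_left:
  "i \<le> length L \<Longrightarrow> drop i (join L R) = map ((+) (length R)) (drop i L) @ Suc (length L + length R) # R"
  by (simp add: join_def drop_map)

text \<open>The maximum of \<open>join L R\<close> stands at position \<open>length L\<close>, hence
  at \<open>length L - i\<close> in a window that starts at \<open>i\<close> and covers it. This
  locates both consecutive matches and suffix matches.\<close>

lemma red_factor_join_max:
  assumes "set L = {1..length L}" "set R = {1..length R}"
    and "i \<le> length L" "length L < i + k" "i + k \<le> length (join L R)"
  shows "red (take k (drop i (join L R))) ! (length L - i) = k"
proof -
  let ?w = "take k (drop i (join L R))"
  have len: "length ?w = k"
    using assms(5) by simp
  have nth: "?w ! (length L - i) = Suc (length L + length R)"
    using assms by simp
  have "u \<le> Suc (length L + length R)" if "u \<in> set ?w" for u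
    using that set_join[OF assms(1,2)] by (auto dest!: in_set_takeD in_set_dropD)
  then show ?thesis
    using red_nth_max[of ?w "length L - i"] distinct_join[OF assms(1,2)] assms(3,4)
    unfolding nth len by simp
qed

text \<open>Since the two last letters of \<open>\<gamma>\<close> are its maximum and its minimum, a match in \<open>join L R\<close>
  that uses the maximum consists of a suffix of \<open>L\<close>, the maximum and the first letter of \<open>R\<close>.\<close>

lemma mch_join:
  assumes L: "set L = {1..length L}" and R: "set R = {1..length R}"
    and \<gamma>: "\<gamma> = map Suc \<delta> @ [length \<delta> + 2, 1]" and \<delta>: "set \<delta> \<subseteq> {..length \<delta>}"
  shows "mch \<gamma> (join L R) = mch \<gamma> L + mch \<gamma> R + of_bool (suffix_match \<delta> L \<and> R \<noteq> [])"
proof -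
  let ?J = "join L R" and ?m = "length \<gamma>" and ?l = "length L" and ?d = "length \<delta>"
  have m: "?m = ?d + 2"
    by (simp add: \<gamma>)
  define M where "M \<sigma> = {i. i + ?m \<le> length \<sigma> \<and> red (take ?m (drop i \<sigma>)) = \<gamma>}" for \<sigma>
  have fin: "finite (M \<sigma>)" for \<sigma>
    by (rule finite_subset[of _ "{..length \<sigma>}"]) (auto simp: M_def)
  have left: "i \<in> M ?J \<longleftrightarrow> i \<in> M L" if "i + ?m \<le> ?l" for i
  proof -
    have "take ?m (drop i ?J) = map ((+) (length R)) (take ?m (drop i L))"
      using that by (simp add: drop_join_left take_map)
    then show ?thesis
      using that by (simp add: M_def)
  qed
  have right: "Suc (?l + j) \<in> M ?J \<longleftrightarrow> j \<in> M R" for j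
  proof -
    have "drop (Suc (?l + j)) ?J = drop j R"
      by (simp add: join_def)
    then show ?thesis
      by (auto simp: M_def)
  qed
  \<comment> \<open>These are the windows that cover the maximum, which stands at position
    \<open>?l\<close>.\<close>
  have mid: "i \<in> M ?J \<longleftrightarrow> suffix_match \<delta> L \<and> R \<noteq> [] \<and> i = ?l - ?d"
    if i: "i \<le> ?l" "?l < i + ?m" for i
  proof -
    have win: "red (take ?m (drop i ?J)) = map Suc (red (drop i L) @ [Suc (length (drop i L))]) @ [1]"
      if "?l = i + ?d" "R \<noteq> []" for i
    proof -
      obtain r R' where R': "R = r # R'"
        using \<open>R \<noteq> []\<close> by (auto simp: neq_Nil_conv)
      let ?w = "map ((+) (length R)) (drop i L)" and ?N = "Suc (?l + length R)"
      have "take ?m (drop i ?J) = (?w @ [?N]) @ [r]"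
        using \<open>?l = i + ?d\<close> by (simp add: drop_join_left m R')
      \<comment> \<open>The first letter of \<open>R\<close> is the minimum of the window, because
        the shift puts the letters of \<open>L\<close> above \<open>length R\<close>.\<close>
      moreover have "r < u" if "u \<in> set (?w @ [?N])" for u
      proof -
        have "r \<le> length R"
          using R by (auto simp: R' set_eq_iff)
        moreover have "length R < u"
          using that L by (auto dest!: in_set_dropD)
        ultimately show ?thesis by simp
      qed
      moreover have "distinct ?w"
        using L card_distinct[of L] by (simp add: distinct_map)
      moreover have "u < ?N" if "u \<in> set ?w" for u
        using that L by (auto dest!: in_set_dropD)
      ultimately show ?thesis
        using red_snoc_min[of "?w @ [?N]" r] red_snoc_max[of ?w ?N] by simp
    qed
    show ?thesis
    proof
      assume mem: "i \<in> M ?J"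
      then have len: "i + ?m \<le> length ?J" and red: "red (take ?m (drop i ?J)) = \<gamma>"
        by (simp_all add: M_def)
      have "\<gamma> ! (?l - i) = ?m"
        using red_factor_join_max[OF L R i len] red by simp
      then have *: "(map Suc \<delta> @ [?d + 2, 1]) ! (?l - i) = ?d + 2"
        by (simp add: \<gamma>)
      \<comment> \<open>The value \<open>?d + 2\<close> occurs in \<open>\<gamma>\<close> only at
        index \<open>?d\<close>: the entries before it are at most \<open>?d + 1\<close>, and the
        one after it is 1.\<close>
      have "\<not> ?l - i < ?d"
      proof
        assume lt: "?l - i < ?d"
        then have "\<delta> ! (?l - i) \<in> {..?d}"
          using \<delta> nth_mem by blast
        with * lt show False
          by (simp add: nth_append)
      qed
      moreover have "?l - i < ?d + 2"
        using i m by simp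
      moreover have "?l - i \<noteq> Suc ?d"
        using * by (auto simp: nth_append)
      ultimately have l: "?l = i + ?d"
        using i by linarith
      then have "R \<noteq> []"
        using len m by auto
      moreover have "red (drop i L) = \<delta>"
        using win[OF l \<open>R \<noteq> []\<close>] red by (simp add: \<gamma> inj_map_eq_map)
      ultimately show "suffix_match \<delta> L \<and> R \<noteq> [] \<and> i = ?l - ?d"
        using l by (simp add: suffix_match_def)
    next
      assume *: "suffix_match \<delta> L \<and> R \<noteq> [] \<and> i = ?l - ?d"
      then have l: "?l = i + ?d" and red: "red (drop i L) = \<delta>"
        by (auto simp: suffix_match_def)
      have ne: "R \<noteq> []"
        using * by blast
      have "length (drop i L) = ?d"
        by (simp add: l)
      then have "red (take ?m (drop i ?J)) = \<gamma>"
        unfolding win[OF l ne] red by (simp add: \<gamma>)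
      moreover have "i + ?m \<le> length ?J"
        using ne l m by (simp add: Suc_le_eq)
      ultimately show "i \<in> M ?J"
        by (simp add: M_def)
    qed
  qed
  define C where "C = (if suffix_match \<delta> L \<and> R \<noteq> [] then {?l - ?d} else {})"
  have M_le: "j + ?m \<le> length \<sigma>" if "j \<in> M \<sigma>" for j \<sigma>
    using that by (simp add: M_def)
  have C_eq: "i \<in> C \<longleftrightarrow> suffix_match \<delta> L \<and> R \<noteq> [] \<and> i = ?l - ?d" for i
    by (simp add: C_def)
  have C_le: "i \<le> ?l \<and> ?l < i + ?m" if "i \<in> C" for i
    using that m by (auto simp: C_eq)
  \<comment> \<open>A window ends before the maximum, covers it or starts after it. These cases give
    the matches in \<open>L\<close>, at most one new match, and the matches in \<open>R\<close>
    moved by \<open>Suc ?l\<close>.\<close>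
  have "M ?J = (M L \<union> C) \<union> (\<lambda>j. Suc (?l + j)) ` M R" (is "_ = ?U")
  proof (rule set_eqI)
    fix i
    consider "i + ?m \<le> ?l" | "i \<le> ?l" "?l < i + ?m" | j where "i = Suc (?l + j)"
      by (metis add_Suc less_iff_Suc_add not_le)
    then show "i \<in> M ?J \<longleftrightarrow> i \<in> ?U"
    proof cases
      case 1
      then show ?thesis
        using left[OF 1] C_le[of i] by auto
    next
      case 2
      then show ?thesis
        using mid[OF 2] C_eq[of i] M_le[of i L] by auto
    next
      case 3
      have "i \<notin> M L" "i \<notin> C"
        using M_le[of i L] C_le[of i] 3 by auto
      with 3 right[of j] show ?thesis by auto
    qed
  qed
  moreover have "(M L \<union> C) \<inter> (\<lambda>j. Suc (?l + j)) ` M R = {}"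
    using M_le[of _ L] C_le by fastforce
  moreover have "M L \<inter> C = {}"
    using M_le[of _ L] C_le by fastforce
  moreover have "card ((\<lambda>j. Suc (?l + j)) ` M R) = card (M R)"
    by (rule card_image) (simp add: inj_on_def)
  moreover have "finite C" "card C = of_bool (suffix_match \<delta> L \<and> R \<noteq> [])"
    by (auto simp: C_def)
  ultimately have "card (M ?J) = card (M L) + card (M R) + of_bool (suffix_match \<delta> L \<and> R \<noteq> [])"
    using fin by (simp add: card_Un_disjoint)
  then show ?thesis
    by (simp add: mch_def M_def)
qed

lemma suffix_match_join_right:
  "length p \<le> length R \<Longrightarrow> suffix_match p (join L R) \<longleftrightarrow> suffix_match p R"
  using drop_join_right[of "length p" R L] by (simp add: suffix_match_def)

text \<open>A suffix of \<open>join L R\<close> that is longer than \<open>R\<close> contains the maximum, whose position fixes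
  the position of the maximum of the pattern.\<close>

lemma suffix_match_join_max:
  assumes "set L = {1..length L}" "set R = {1..length R}"
    and "length R < length p" "suffix_match p (join L R)"
  shows "p ! (length p - Suc (length R)) = length p"
proof -
  let ?i = "length (join L R) - length p"
  have le: "length p \<le> Suc (length L + length R)" and red: "red (drop ?i (join L R)) = p"
    using assms(4) by (simp_all add: suffix_match_def)
  have "red (take (length p) (drop ?i (join L R))) ! (length L - ?i) = length p"
    by (rule red_factor_join_max) (use assms le in auto)
  moreover have "length L - ?i = length p - Suc (length R)"
    using le assms(3) by simp
  ultimately show ?thesis
    using red le by simp
qed

text \<open>A suffix longer than \<open>R\<close> covers the maximum, which must then be its last
  letter. So \<open>R\<close> is empty and the rest of the suffix is a copy of \<open>p\<close> at
  the end of \<open>L\<close>.\<close>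

lemma suffix_match_join_snoc:
  assumes "set L = {1..length L}" "set R = {1..length R}" "set p \<subseteq> {..length p}"
  shows "suffix_match (p @ [Suc (length p)]) (join L R) \<longleftrightarrow>
    (R = [] \<and> suffix_match p L) \<or> suffix_match (p @ [Suc (length p)]) R"
proof (cases "length R \<le> length p")
  case False
  then show ?thesis
    by (subst suffix_match_join_right) auto
next
  case True
  let ?p = "p @ [Suc (length p)]"
  have *: "\<not> suffix_match ?p R"
    using True by (simp add: suffix_match_def)
  show ?thesis
  proof (cases "R = []")
    case False
    have "\<not> suffix_match ?p (join L R)"
    proof
      assume "suffix_match ?p (join L R)"
      from suffix_match_join_max[OF assms(1,2) _ this] True
      have "?p ! (length p - length R) = Suc (length p)"
        by simp
      moreover have lt: "length p - length R < length p"
        using False True by (simp add: length_greater_0_conv[symmetric] del: length_greater_0_conv)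
      moreover from lt have "p ! (length p - length R) \<in> {..length p}"
        using assms(3) nth_mem by blast
      ultimately show False
        by (simp add: nth_append)
    qed
    with * False show ?thesis by simp
  next
    case R: True
    have dist: "distinct (drop i L)" for i
      using assms(1) card_distinct[of L] by simp
    have "red (drop i (join L [])) = red (drop i L) @ [Suc (length (drop i L))]" if "i \<le> length L" for i
    proof -
      have "drop i (join L []) = drop i L @ [Suc (length L)]"
        using that by (simp add: drop_join_left map_idI)
      moreover have "u < Suc (length L)" if "u \<in> set (drop i L)" for u
        using in_set_dropD[OF that] assms(1) by auto
      ultimately show ?thesis
        using red_snoc_max[OF dist, of i "Suc (length L)"] by simp
    qed
    with R * show ?thesis
      by (auto simp: suffix_match_def)
  qed
qed

text \<open>A suffix longer than \<open>R\<close> must now start at the maximum, so it consists of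
  the maximum and all of \<open>R\<close>. As \<open>R\<close> is its own reduction, it equals
  \<open>q\<close>, while \<open>L\<close> is arbitrary.\<close>

lemma suffix_match_join_Cons:
  assumes "set L = {1..length L}" "set R = {1..length R}" "set q = {1..length q}"
  shows "suffix_match (Suc (length q) # q) (join L R) \<longleftrightarrow>
    R = q \<or> suffix_match (Suc (length q) # q) R"
proof (cases "length R \<le> length q")
  case False
  then show ?thesis
    by (subst suffix_match_join_right) auto
next
  case True
  let ?p = "Suc (length q) # q"
  have *: "\<not> suffix_match ?p R"
    using True by (simp add: suffix_match_def)
  show ?thesis
  proof (cases "length R = length q")
    case False
    have "\<not> suffix_match ?p (join L R)"
    proof
      assume "suffix_match ?p (join L R)"
      from suffix_match_join_max[OF assms(1,2) _ this] True
      have "?p ! (length q - length R) = Suc (length q)"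
        by simp
      moreover have "?p ! (length q - length R) = q ! (length q - Suc (length R))"
        and lt: "length q - Suc (length R) < length q"
        using False True by (simp_all add: nth_Cons')
      moreover from lt have "q ! (length q - Suc (length R)) \<in> {1..length q}"
        using assms(3) nth_mem by blast
      ultimately show False
        by simp
    qed
    with * False show ?thesis by auto
  next
    case len: True
    have "red (Suc (length L + length R) # R) = Suc (length R) # red R"
      using assms(2) card_distinct[of R] by (intro red_Cons_max) auto
    moreover have "drop (length L) (join L R) = Suc (length L + length R) # R"
      by (simp add: join_def)
    ultimately show ?thesis
      using len * red_ident[OF assms(2)] by (auto simp: suffix_match_def)
  qed
qed

section \<open>The pattern and its prefixes\<close>

lemma avoids_132_if_sorted:
  assumes "sorted \<sigma>"
  shows "avoids \<sigma> [1, 3, 2]"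
  unfolding avoids_132_iff
proof (intro allI impI)
  fix x y z assume "subseq [x, z, y] \<sigma>"
  with assms have "sorted [x, z, y]"
    by (auto simp only: subseq_conv_nths intro: sorted_nths)
  then show "\<not> y < z" by simp
qed

text \<open>The reduction of the first \<open>a - 1 + k\<close> letters of \<open>\<gamma>\<close>, for \<open>k \<le> m - 1 - a\<close>.\<close>

definition gamma_prefix :: "nat \<Rightarrow> nat \<Rightarrow> nat list" where
  "gamma_prefix a k = (a - 1) # [1..<a - 1] @ [a..<a + k]"

text \<open>The shortest prefix begins with its maximum, the shape treated by
  \<open>suffix_match_join_Cons\<close>.\<close>

lemma gamma_prefix_0:
  assumes "2 \<le> a"
  shows "gamma_prefix a 0 = Suc (length [1..<a - 1]) # [1..<a - 1]"
  using assms by (simp add: gamma_prefix_def)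

text \<open>Each further letter is a new maximum, the shape treated by
  \<open>suffix_match_join_snoc\<close>.\<close>

lemma gamma_prefix_Suc:
  assumes "2 \<le> a"
  shows "gamma_prefix a (Suc k) = gamma_prefix a k @ [Suc (length (gamma_prefix a k))]"
  using assms by (simp add: gamma_prefix_def)

lemma set_gamma_prefix: "2 \<le> a \<Longrightarrow> set (gamma_prefix a k) \<subseteq> {..length (gamma_prefix a k)}"
  by (auto simp: gamma_prefix_def)

text \<open>Removing the final 1 lowers all other ranks by one, whence \<open>map Suc\<close>; the
  entry \<open>length \<delta> + 2\<close> is the maximum \<open>m\<close>. This is the form that
  \<open>mch_join\<close> expects.\<close>

lemma gamma_perm_eq:
  assumes "3 \<le> a" "a \<le> m - 1"
  defines "\<delta> \<equiv> gamma_prefix a (m - 1 - a)"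
  shows "gamma_perm a m = map Suc \<delta> @ [length \<delta> + 2, 1]"
proof -
  have "sorted_list_of_set ({2..m} - {a}) = [2..<a] @ [Suc a..<Suc m]"
    by (rule sorted_distinct_set_unique) (use assms in \<open>auto simp: sorted_append\<close>)
  moreover have "[Suc a..<Suc m] = [Suc a..<m] @ [m]"
    using assms by simp
  moreover have "map Suc \<delta> = a # [2..<a] @ [Suc a..<m]" "length \<delta> + 2 = m"
    using assms by (simp_all add: gamma_prefix_def map_Suc_upt numeral_2_eq_2 flip: upt_Suc)
  ultimately show ?thesis
    by (simp add: gamma_perm_def)
qed

section \<open>The functional equation for \<open>B\<close>, cleared of denominators\<close>

lemma match_gf_132_functional_equation:
  fixes a m :: nat
  assumes a: "3 \<le> a" and m: "a \<le> m - 1"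
  defines "B \<equiv> match_gf [1, 3, 2] (gamma_perm a m)"
    and "t \<equiv> (fps_X :: rat poly fps)"
    and "x \<equiv> fps_const ([:0, 1:] :: rat poly)"
  shows "B \<noteq> 0" "B \<noteq> 1"
    "B * ((B - 1) * B ^ (m - a - 1)) =
      t * B ^ (m - a + 2) + t ^ (a - 2) * (x - 1) * (B - 1 - t * B) * (B - 1) ^ (m - a)"
proof -
  define K where "K = m - 1 - a"
  let ?\<gamma> = "gamma_perm a m" and ?\<delta> = "gamma_prefix a"
  define q where "q = [1..<a - 1]"
  let ?x = "[:0, 1:] :: rat poly"
  define W where "W \<sigma> = ?x ^ mch ?\<gamma> \<sigma>" for \<sigma>
  define e where "e k \<sigma> = (of_bool (suffix_match (?\<delta> k) \<sigma>) :: rat poly)" for k \<sigma>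
  \<comment> \<open>The weight of a left part followed by the maximum and a nonempty right part:
    \<open>W\<close> gains a factor \<open>?x\<close> if the left part completes a match. Its
    generating function is \<open>P\<close>.\<close>
  define U where "U \<sigma> = W \<sigma> + (?x - 1) * (e K \<sigma> * W \<sigma>)" for \<sigma>
  define F where "F k = avoider_gf (\<lambda>\<sigma>. e k \<sigma> * W \<sigma>)" for k
  define P where "P = B + (x - 1) * F K"
  have a2: "2 \<le> a" using a by simp
  have len_\<gamma>: "length ?\<gamma> = m" and \<gamma>: "?\<gamma> = map Suc (?\<delta> K) @ [length (?\<delta> K) + 2, 1]"
    using gamma_perm_eq[OF a m] a m by (simp_all add: K_def gamma_prefix_def)
  have mch_0: "mch ?\<gamma> \<sigma> = 0" if "length \<sigma> < m" for \<sigma>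
    using that by (simp add: mch_def len_\<gamma>)
  \<comment> \<open>Both words are shorter than \<open>?\<gamma>\<close>.\<close>
  have W_Nil: "W [] = 1" and W_q: "W q = 1"
    unfolding W_def by (subst mch_0; use a m in \<open>simp add: q_def\<close>)+
  have e_Nil: "e k [] = 0" for k
    by (simp add: e_def suffix_match_def gamma_prefix_def)

  have B: "B = avoider_gf W"
    by (simp add: B_def match_gf_def avoider_gf_def W_def)
  have U: "avoider_gf U = P"
  proof -
    have "fps_const (?x - 1) = x - 1"
      unfolding x_def by (simp only: fps_const_sub [symmetric] fps_const_1_eq_1)
    then show ?thesis
      unfolding U_def [abs_def] avoider_gf_add avoider_gf_cmult P_def B F_def by simp
  qed
  have gf_Nil: "avoider_gf (\<lambda>\<sigma>. of_bool (\<sigma> = []) * W \<sigma>) = 1"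
    using avoider_gf_of_bool[of "[]" 0 W] avoiders_0 by (simp add: W_Nil)
  have gf_not_Nil: "avoider_gf (\<lambda>\<sigma>. if \<sigma> = [] then 0 else W \<sigma>) = B - 1"
  proof -
    have "B = avoider_gf (\<lambda>\<sigma>. of_bool (\<sigma> = []) * W \<sigma> + (if \<sigma> = [] then 0 else W \<sigma>))"
      unfolding B by (rule arg_cong[of _ _ avoider_gf]) auto
    then show ?thesis
      unfolding avoider_gf_add gf_Nil by simp
  qed
  \<comment> \<open>The source of \<open>t ^ (a - 2)\<close>: the single word \<open>q\<close> has
    length \<open>a - 2\<close> and weight 1.\<close>
  have gf_q: "avoider_gf (\<lambda>\<sigma>. of_bool (\<sigma> = q) * W \<sigma>) = t ^ (a - 2)"
  proof -
    have "q \<in> avoiders (a - 2) [1, 3, 2]"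
      using a avoids_132_if_sorted[of q] by (auto simp: q_def avoiders_def permutations_of_set_def)
    from avoider_gf_of_bool[OF this, of W] show ?thesis
      unfolding W_q t_def by simp
  qed

  have mch: "mch ?\<gamma> (join L R) = mch ?\<gamma> L + mch ?\<gamma> R + of_bool (suffix_match (?\<delta> K) L \<and> R \<noteq> [])"
    if "set L = {1..length L}" "set R = {1..length R}" for L R
    using mch_join[OF that \<gamma>] set_gamma_prefix[OF a2] by simp
  have W_join: "W (join L R) = (if R = [] then W L else U L * W R)"
    if "set L = {1..length L}" "set R = {1..length R}" for L R
    using mch[OF that] mch_0[of "[]"] m a
    by (auto simp: W_def U_def e_def power_add algebra_simps)

  have B_eq: "B - 1 = t * (B + P * (B - 1))"
  proof -
    \<comment> \<open>Indicators of empty and nonempty \<open>R\<close> turn the case distinction of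
      \<open>W_join\<close> into a sum of two products.\<close>
    have "pair_gf (\<lambda>L R. W (join L R)) =
      pair_gf (\<lambda>L R. W L * (of_bool (R = []) * W R) + U L * (if R = [] then 0 else W R))"
      by (rule pair_gf_cong) (use W_Nil in \<open>simp add: W_join\<close>)
    also have "\<dots> = B + P * (B - 1)"
      by (simp only: pair_gf_add pair_gf_mult gf_Nil gf_not_Nil U B [symmetric] mult_1_right)
    finally have "B = 1 + t * (B + P * (B - 1))"
      using avoider_gf_rec[of W] by (simp add: B [symmetric] W_Nil t_def)
    from arg_cong[OF this, of "\<lambda>f. f - 1"] show ?thesis
      by (simp only: add_diff_cancel_left')
  qed
  have F_Suc: "F (Suc k) = t * (F k + P * F (Suc k))" for k
  proof -
    have "suffix_match (?\<delta> (Suc k)) (join L R) \<longleftrightarrow>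
        R = [] \<and> suffix_match (?\<delta> k) L \<or> suffix_match (?\<delta> (Suc k)) R"
      if "set L = {1..length L}" "set R = {1..length R}" for L R
      unfolding gamma_prefix_Suc[OF a2]
      by (rule suffix_match_join_snoc[OF that set_gamma_prefix[OF a2]])
    \<comment> \<open>The two alternatives exclude each other, because a suffix match in
      \<open>R\<close> forces \<open>R\<close> to be nonempty; so the indicator of their disjunction
      is a sum.\<close>
    then have "pair_gf (\<lambda>L R. e (Suc k) (join L R) * W (join L R)) =
      pair_gf (\<lambda>L R. (e k L * W L) * (of_bool (R = []) * W R) + U L * (e (Suc k) R * W R))"
      by (intro pair_gf_cong) (use W_Nil e_Nil[of "Suc k"] in \<open>auto simp: W_join e_def\<close>)
    also have "\<dots> = F k + P * F (Suc k)"
      unfolding pair_gf_add pair_gf_mult gf_Nil U F_def by simp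
    finally show ?thesis
      using avoider_gf_rec[of "\<lambda>\<sigma>. e (Suc k) \<sigma> * W \<sigma>"] by (simp add: F_def e_Nil t_def)
  qed
  have F_0: "F 0 = t * (P * t ^ (a - 2) + P * F 0)"
  proof -
    \<comment> \<open>Since \<open>3 \<le> a\<close>, the word \<open>q\<close> is nonempty, so both
      alternatives below carry the factor \<open>U L\<close>.\<close>
    have q: "set q = {1..length q}" "q \<noteq> []"
      using a by (auto simp: q_def)
    \<comment> \<open>The word \<open>q\<close> is one letter shorter than the pattern, so the
      alternatives are disjoint.\<close>
    have e0: "e 0 (join L R) = of_bool (R = q) + e 0 R"
      if "set L = {1..length L}" "set R = {1..length R}" for L R
      using suffix_match_join_Cons[OF that q(1)]
      by (auto simp: e_def gamma_prefix_0[OF a2, folded q_def] suffix_match_def)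
    have "pair_gf (\<lambda>L R. e 0 (join L R) * W (join L R)) =
      pair_gf (\<lambda>L R. U L * (of_bool (R = q) * W R) + U L * (e 0 R * W R))"
      by (intro pair_gf_cong) (use q(2) e_Nil[of 0] in \<open>auto simp: W_join e0 algebra_simps\<close>)
    also have "\<dots> = P * t ^ (a - 2) + P * F 0"
      unfolding pair_gf_add pair_gf_mult gf_q U F_def by simp
    finally show ?thesis
      using avoider_gf_rec[of "\<lambda>\<sigma>. e 0 \<sigma> * W \<sigma>"] by (simp add: F_def e_Nil t_def)
  qed

  have t: "t \<noteq> 0"
    by (simp add: t_def)
  have "fps_nth B 0 = 1"
    using arg_cong[OF B_eq, of "\<lambda>f. fps_nth f 0"] by (simp add: t_def)
  then show B0: "B \<noteq> 0"
    by auto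
  \<comment> \<open>For \<open>B = 1\<close> the equation \<open>B_eq\<close> would read
    \<open>0 = t\<close>.\<close>
  show "B \<noteq> 1"
    using B_eq t by auto

  define d where "d = B - 1"
  have B1: "B = d + 1"
    by (simp add: d_def)
  \<comment> \<open>This eliminates \<open>P\<close>: multiplied by \<open>d\<close>, the equations
    for \<open>F\<close> contain \<open>P\<close> only in the product
    \<open>t * P * d\<close>.\<close>
  have tPd: "t * P * d = d - t * B"
    using B_eq by (simp add: d_def algebra_simps)
  have step: "B * F (Suc k) = d * F k" for k
  proof -
    have "d * F (Suc k) = d * (t * (F k + P * F (Suc k)))"
      using F_Suc[of k] by simp
    also have "\<dots> = t * d * F k + (t * P * d) * F (Suc k)"
      by (simp add: algebra_simps)
    \<comment> \<open>After the substitution the terms \<open>d * F (Suc k)\<close> on both sides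
      cancel.\<close>
    finally have "t * (B * F (Suc k)) = t * (d * F k)"
      unfolding tPd by (simp add: algebra_simps)
    with t show ?thesis by simp
  qed
  have B_pow: "B ^ k * F k = d ^ k * F 0" for k
  proof (induction k)
    case (Suc k)
    have "B ^ Suc k * F (Suc k) = B ^ k * (B * F (Suc k))"
      by (simp add: algebra_simps)
    also have "\<dots> = d * (B ^ k * F k)"
      unfolding step by (simp add: algebra_simps)
    finally show ?case
      unfolding Suc by (simp add: algebra_simps)
  qed simp
  have B_F0: "t * B * F 0 = (d - t * B) * t ^ (a - 2)"
  proof -
    have "d * F 0 = d * (t * (P * t ^ (a - 2) + P * F 0))"
      using F_0 by simp
    also have "\<dots> = (t * P * d) * t ^ (a - 2) + (t * P * d) * F 0"
      by (simp add: algebra_simps)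
    finally show ?thesis
      unfolding tPd by (simp add: algebra_simps)
  qed
  have exps: "m - a - 1 = K" "m - a + 2 = K + 3" "m - a = Suc K"
    using a m by (auto simp: K_def)
  \<comment> \<open>With \<open>P\<close> expanded, the terms without \<open>F K\<close> combine
    through \<open>d + 1 = B\<close>. In the remaining term, \<open>B ^ K\<close> is absorbed by
    \<open>B_pow\<close> and the last factor \<open>B\<close> by \<open>B_F0\<close>.\<close>
  have "d * B ^ Suc K = (t * B + t * P * d) * B ^ Suc K"
    unfolding tPd by simp
  also have "\<dots> = t * B ^ (K + 3) + (x - 1) * d * (t * B) * (B ^ K * F K)"
    by (simp add: P_def B1 algebra_simps power_add numeral_3_eq_3)
  also have "\<dots> = t * B ^ (K + 3) + (x - 1) * d ^ Suc K * (t * B * F 0)"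
    unfolding B_pow by (simp add: algebra_simps)
  finally show "B * ((B - 1) * B ^ (m - a - 1)) =
      t * B ^ (m - a + 2) + t ^ (a - 2) * (x - 1) * (B - 1 - t * B) * (B - 1) ^ (m - a)"
    unfolding B_F0 exps d_def [symmetric] by (simp add: algebra_simps power_add numeral_3_eq_3)
qed

section \<open>Transfer to the fraction field\<close>

lemma to_fract_power [simp]: "to_fract (x ^ n) = to_fract x ^ n"
  by (induction n) simp_all

theorem theorem16:
  fixes a m :: nat and B t x :: "rat poly fps fract"
  assumes "3 \<le> a" and "a \<le> m - 1"
  defines "B \<equiv> to_fract (match_gf [1, 3, 2] (gamma_perm a m))"
    and "t \<equiv> to_fract fps_X"
    and "x \<equiv> to_fract (fps_const [:0, 1:])"
  shows "B = (t * B ^ (m - a + 2) + t ^ (a - 2) * (x - 1) * (B - 1 - t * B) * (B - 1) ^ (m - a))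
             / ((B - 1) * B ^ (m - a - 1))"
proof -
  note gf = match_gf_132_functional_equation[OF assms(1,2)]
  \<comment> \<open>The denominator is nonzero since \<open>to_fract\<close> is injective.\<close>
  have "B \<noteq> 0" "B - 1 \<noteq> 0"
    using gf(1,2) by (simp_all add: B_def flip: to_fract_1)
  moreover have "B * ((B - 1) * B ^ (m - a - 1)) =
      t * B ^ (m - a + 2) + t ^ (a - 2) * (x - 1) * (B - 1 - t * B) * (B - 1) ^ (m - a)"
    using arg_cong[OF gf(3), of to_fract] by (simp add: B_def t_def x_def)
  ultimately show ?thesis
    by (simp add: eq_divide_eq)
qed

end
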